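(* Let $c>0$ and $\gamma>0$, and let $W$ be the scale function of the spectrally negative Lévy process with Laplace exponent $$\psi(\theta)=-c\,\theta\log\left(\frac{\gamma}{\gamma+\theta}\right).$$ Then, for $x\ge 0$, $$W(x)=\int_0^\infty P(ct,\gamma x)\,dt,$$ where $P(a,x)$ is the regularized lower incomplete gamma function.
   Context: A spectrally negative Lévy process $X$ is a real-valued Lévy process with no positive jumps which is not the negative of a subordinator; its Laplace exponent is $\psi(\theta)=\log\mathbb{E}[e^{\theta X_1}]$, $\Re(\theta)\ge 0$, and $\Phi(0)=\sup\{\theta\ge 0:\psi(\theta)=0\}$. The scale function $W=W^{(0)}:\mathbb{R}\to[0,\infty)$ is zero on $(-\infty,0)$, continuous on $[0,\infty)$ (right continuous at the origin), and determined by $\int_0^\infty e^{-\theta x}W(x)\,dx=1/\psi(\theta)$ for $\Re(\theta)>\Phi(0)$. The process considered is the parent process whose descending ladder height process is the unkilled, driftless gamma subordinator with Laplace exponent $\phi(\theta)=-c\log(\gamma/(\gamma+\theta))$ and Lévy measure $c x^{-1}e^{-\gamma x}dx$ on $(0,\infty)$; that is, $\psi(\theta)=\theta\phi(\theta)$, which is known to be the Laplace exponent of a spectrally negative Lévy process. The regularized lower incomplete gamma function is $P(a,x)=\frac{1}{\Gamma(a)}\int_0^x u^{a-1}e^{-u}\,du$ for $a>0$, $x\ge 0$. *)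

theory Defs
  imports "HOL-Probability.Probability"
begin

locale levy_process = prob_space M for M :: "'a measure" +
  fixes X :: "real \<Rightarrow> 'a \<Rightarrow> real"
  assumes random_variable_X: "\<And>t. 0 \<le> t \<Longrightarrow> random_variable borel (X t)"
    and start_zero: "AE \<omega> in M. X 0 \<omega> = 0"
    and cadlag: "AE \<omega> in M.
        (\<forall>t\<ge>0. continuous (at_right t) (\<lambda>s. X s \<omega>)) \<and>
        (\<forall>t>0. \<exists>l. ((\<lambda>s. X s \<omega>) \<longlongrightarrow> l) (at_left t))"
    and stationary_increments: "\<And>s t. 0 \<le> s \<Longrightarrow> 0 \<le> t \<Longrightarrow>
        distr M borel (\<lambda>\<omega>. X (s + t) \<omega> - X s \<omega>) = distr M borel (X t)"
    and independent_increments: "\<And>(n::nat) (\<tau> :: nat \<Rightarrow> real).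
        0 \<le> \<tau> 0 \<Longrightarrow> (\<And>k. k < n \<Longrightarrow> \<tau> k \<le> \<tau> (Suc k)) \<Longrightarrow>
        indep_vars (\<lambda>_. borel) (\<lambda>k \<omega>. X (\<tau> (Suc k)) \<omega> - X (\<tau> k) \<omega>) {..<n}"

locale subordinator = levy_process +
  assumes nondecreasing_paths: "AE \<omega> in M. mono_on {0..} (\<lambda>t. X t \<omega>)"

locale spectrally_negative_levy_process = levy_process +
  assumes no_positive_jumps:
      "AE \<omega> in M. \<forall>t>0. X t \<omega> - Lim (at_left t) (\<lambda>s. X s \<omega>) \<le> 0"
    and not_negative_subordinator: "\<not> subordinator M (\<lambda>t \<omega>. - X t \<omega>)"

text \<open>
  For complex arguments the logarithm of the Laplace transform of \<open>X 1\<close> is its distinguished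
  logarithm: the continuous branch on the closed right half-plane that vanishes at the origin.
  The values of \<open>\<psi>\<close> elsewhere are irrelevant.  Integrability of \<open>exp (\<theta> * X 1)\<close> need not be
  demanded, as the Bochner integral of a non-integrable function is 0, which is not of the
  form \<open>exp z\<close>.
\<close>
definition laplace_exponent ::
    "'a measure \<Rightarrow> (real \<Rightarrow> 'a \<Rightarrow> real) \<Rightarrow> (complex \<Rightarrow> complex) \<Rightarrow> bool" where
  "laplace_exponent M X \<psi> \<longleftrightarrow>
     continuous_on {\<theta>. 0 \<le> Re \<theta>} \<psi> \<and> \<psi> 0 = 0 \<and>
     (\<forall>\<theta>. 0 \<le> Re \<theta> \<longrightarrow>
        exp (\<psi> \<theta>) = integral\<^sup>L M (\<lambda>\<omega>. exp (\<theta> * complex_of_real (X 1 \<omega>))))"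

definition Phi_zero :: "(complex \<Rightarrow> complex) \<Rightarrow> real" where
  "Phi_zero \<psi> = Sup {\<theta> :: real. 0 \<le> \<theta> \<and> \<psi> (complex_of_real \<theta>) = 0}"

definition scale_function :: "(complex \<Rightarrow> complex) \<Rightarrow> (real \<Rightarrow> real) \<Rightarrow> bool" where
  "scale_function \<psi> W \<longleftrightarrow>
     (\<forall>x. 0 \<le> W x) \<and> (\<forall>x<0. W x = 0) \<and> continuous_on {0..} W \<and>
     (\<forall>\<theta>. Phi_zero \<psi> < Re \<theta> \<longrightarrow>
        set_integrable lborel {0..}
          (\<lambda>x. exp (- \<theta> * complex_of_real x) * complex_of_real (W x)) \<and>
        (LINT x:{0..}|lborel. exp (- \<theta> * complex_of_real x) * complex_of_real (W x))
          = 1 / \<psi> \<theta>)"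

text \<open>The regularized lower incomplete gamma function, meant for \<open>a > 0\<close> and \<open>x \<ge> 0\<close>.\<close>
definition regularized_lower_gamma :: "real \<Rightarrow> real \<Rightarrow> real" where
  "regularized_lower_gamma a x =
     1 / Gamma a * (LINT u:{0..x}|lborel. u powr (a - 1) * exp (- u))"

end

theory Submission
  imports Defs "HOL-Real_Asymp.Real_Asymp"
begin

text \<open>
  The exponent factors as \<open>\<psi>(\<theta>) = \<theta> \<phi>(\<theta>)\<close> with \<open>\<phi>(\<theta>) = c ln (1 + \<theta> / \<gamma>)\<close>, the
  Laplace exponent of the gamma subordinator \<open>H\<close> with shape \<open>c * t\<close> and rate \<open>\<gamma>\<close> at
  time \<open>t\<close>. Since \<open>1 / \<phi>(\<theta>)\<close> is the Laplace transform of the renewal measure of \<open>H\<close>,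
  and the factor \<open>1 / \<theta>\<close> corresponds to passing to its distribution function, the scale function
  has to be the renewal function \<open>x \<mapsto> \<integral> P(H t \<le> x) dt\<close> over \<open>t > 0\<close>. By scaling,
  \<open>P(H t \<le> x)\<close> is the regularized incomplete gamma function at \<open>(c * t, \<gamma> * x)\<close>.

  The argument has three ingredients. The transform of the renewal function is computed with
  Tonelli's theorem, integrating over \<open>x\<close>, then over the values of \<open>H t\<close>, then over \<open>t\<close>
  (\<open>nn_integral_laplace_gamma_potential\<close>). A Chernoff bound, \<open>regularized_lower_gamma_le\<close>, gives
  the integrability in \<open>t\<close>, and by dominated convergence the continuity of the renewal function
  (\<open>continuous_on_gamma_potential\<close>). As \<open>\<psi>\<close> vanishes on the nonnegative reals only at the
  origin, the transform of the scale function is known at every positive integer, and a continuous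
  function is determined by these values (\<open>laplace_transform_inj_continuous\<close>).
\<close>

section \<open>Uniqueness of the Laplace transform of a continuous function\<close>

text \<open>
  Under \<open>y = exp (- x)\<close> the half-line becomes the unit interval and the integrals in the
  hypothesis become the moments of a finite signed measure there. All moments vanish, hence so do
  the integrals of polynomials, and by the Weierstrass theorem those of continuous functions.
\<close>

lemma integral_against_continuous_eq_0:
  fixes k q :: "real \<Rightarrow> real"
  assumes k: "integrable lborel k" and k0: "\<And>x. x < 0 \<Longrightarrow> k x = 0"
    and mom: "\<And>n::nat. (LINT x|lborel. exp (-x) ^ n * k x) = 0"
    and q: "continuous_on UNIV q"
  shows "integrable lborel (\<lambda>x. q (exp (-x)) * k x)"
    and "(LINT x|lborel. q (exp (-x)) * k x) = 0"
proof -
  have [measurable]: "k \<in> borel_measurable borel" using k by simp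
  have int: "integrable lborel (\<lambda>x. f (exp (-x)) * k x)" if f: "continuous_on UNIV f" for f :: "real \<Rightarrow> real"
  proof -
    have [measurable]: "f \<in> borel_measurable borel" using f by (rule borel_measurable_continuous_onI)
    have "compact (f ` {0..1})"
      by (intro compact_continuous_image continuous_on_subset[OF f]) auto
    then obtain B where B: "\<And>y. y \<in> {0..1} \<Longrightarrow> norm (f y) \<le> B"
      by (meson bounded_iff compact_imp_bounded imageI)
    show ?thesis
    proof (rule Bochner_Integration.integrable_bound[OF integrable_mult_right[OF k, of B]])
      have "norm (f (exp (-x)) * k x) \<le> norm (B * k x)" for x
      proof (cases "x < 0")
        case False
        then have "norm (f (exp (-x))) \<le> B" by (intro B) auto
        then show ?thesis by (auto simp: abs_mult intro!: mult_right_mono)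
      qed (simp add: k0)
      then show "AE x in lborel. norm (f (exp (-x)) * k x) \<le> norm (B * k x)" by simp
    qed simp
  qed
  show "integrable lborel (\<lambda>x. q (exp (-x)) * k x)" by (rule int[OF q])
  define J where "J = (LINT x|lborel. \<bar>k x\<bar>)"
  have J: "J \<ge> 0" unfolding J_def by simp
  have bd: "\<bar>LINT x|lborel. q (exp (-x)) * k x\<bar> \<le> e * J" if e: "e > 0" for e
  proof -
    obtain p where p: "real_polynomial_function p" "\<And>y. y \<in> {0..1} \<Longrightarrow> \<bar>q y - p y\<bar> < e"
      using Stone_Weierstrass_real_polynomial_function[of "{0..1::real}" q e]
        continuous_on_subset[OF q] e by auto
    obtain a n where pan: "p = (\<lambda>y. \<Sum>i\<le>n. a i * y ^ i)"
      using p(1) real_polynomial_function_iff_sum by blast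
    have pc: "continuous_on UNIV p" unfolding pan by (intro continuous_intros)
    have "(LINT x|lborel. p (exp (-x)) * k x) = (LINT x|lborel. (\<Sum>i\<le>n. a i * (exp (-x) ^ i * k x)))"
      by (simp add: pan sum_distrib_right mult.assoc)
    also have "\<dots> = (\<Sum>i\<le>n. LINT x|lborel. a i * (exp (-x) ^ i * k x))"
      by (intro Bochner_Integration.integral_sum integrable_mult_right int[where f="\<lambda>y. y ^ _"] continuous_intros)
    also have "\<dots> = 0" by (simp add: mom del: exp_of_nat_mult)
    finally have p0: "(LINT x|lborel. p (exp (-x)) * k x) = 0" .
    have "\<bar>LINT x|lborel. q (exp (-x)) * k x\<bar> = \<bar>LINT x|lborel. q (exp (-x)) * k x - p (exp (-x)) * k x\<bar>"
      by (subst Bochner_Integration.integral_diff[OF int[OF q] int[OF pc]]) (simp add: p0)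
    also have "\<dots> \<le> (LINT x|lborel. e * \<bar>k x\<bar>)"
    proof (rule order_trans[OF integral_abs_bound])
      show "(LINT x|lborel. \<bar>q (exp (-x)) * k x - p (exp (-x)) * k x\<bar>) \<le> (LINT x|lborel. e * \<bar>k x\<bar>)"
      proof (intro integral_mono)
        show "integrable lborel (\<lambda>x. \<bar>q (exp (-x)) * k x - p (exp (-x)) * k x\<bar>)"
          by (intro integrable_abs Bochner_Integration.integrable_diff int q pc)
        show "integrable lborel (\<lambda>x. e * \<bar>k x\<bar>)" using k by simp
        fix x :: real
        show "\<bar>q (exp (-x)) * k x - p (exp (-x)) * k x\<bar> \<le> e * \<bar>k x\<bar>"
        proof (cases "x < 0")
          case False
          then have "\<bar>q (exp (-x)) - p (exp (-x))\<bar> \<le> e" by (intro less_imp_le p(2)) auto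
          then show ?thesis by (auto simp: abs_mult left_diff_distrib[symmetric] intro!: mult_right_mono)
        qed (simp add: k0)
      qed
    qed
    also have "\<dots> = e * J" by (simp add: J_def)
    finally show ?thesis .
  qed
  have "\<bar>LINT x|lborel. q (exp (-x)) * k x\<bar> \<le> 0 + e" if "e > 0" for e
  proof -
    have "\<bar>LINT x|lborel. q (exp (-x)) * k x\<bar> \<le> e / (J + 1) * J"
      using that J by (intro bd) auto
    also have "\<dots> \<le> e" using that J by (auto simp: field_simps)
    finally show ?thesis by simp
  qed
  then show "(LINT x|lborel. q (exp (-x)) * k x) = 0"
    using field_le_epsilon[of "\<bar>LINT x|lborel. q (exp (-x)) * k x\<bar>" 0] by auto
qed

text \<open>
  If \<open>h\<close> were positive at \<open>x0\<close>, it would be positive on an interval \<open>(a, b)\<close>. Testing it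
  against a bump in the variable \<open>exp (- x)\<close> that lives exactly on this interval would give a
  nonnegative integrand with integral zero that is strictly positive on \<open>(a, b)\<close>.
\<close>

lemma continuous_vanishing_laplace_nonpos:
  fixes h :: "real \<Rightarrow> real"
  assumes cont: "continuous_on {0..} h"
    and int: "set_integrable lborel {0..} (\<lambda>x. exp (-x) * h x)"
    and mom: "\<And>n. n \<ge> 1 \<Longrightarrow> (LINT x:{0..}|lborel. exp (- (real n * x)) * h x) = 0"
    and x0: "x0 > 0"
  shows "h x0 \<le> 0"
proof (rule ccontr)
  assume "\<not> h x0 \<le> 0"
  then have pos: "h x0 > 0" by simp
  have "continuous_on {0<..} h" by (rule continuous_on_subset[OF cont]) auto
  then have "isCont h x0" using x0 by (simp add: continuous_on_eq_continuous_at)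
  then have "\<forall>\<^sub>F x in at x0. 0 < h x" using pos by (simp add: isCont_def order_tendstoD)
  then obtain d where d: "d > 0" "\<And>x. x \<noteq> x0 \<Longrightarrow> dist x x0 < d \<Longrightarrow> 0 < h x"
    by (auto simp: eventually_at)
  \<comment> \<open>The maximum keeps the interval inside the half-line that carries the integrals.\<close>
  define a where "a = max 0 (x0 - d)"
  define b where "b = x0 + d"
  have ab: "a < b" "0 \<le> a" using d x0 by (auto simp: a_def b_def)
  have hpos: "0 < h x" if "a < x" "x < b" for x
    using that pos d by (cases "x = x0") (auto simp: a_def b_def dist_real_def)
  define k where "k = (\<lambda>x. indicator {0..} x * (exp (-x) * h x))"
  define q where "q = (\<lambda>y::real. max 0 (exp (-a) - y) * max 0 (y - exp (-b)))"
  have k: "integrable lborel k" using int by (simp add: k_def set_integrable_def)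
  have kmom: "(LINT x|lborel. exp (-x) ^ n * k x) = 0" for n
  proof -
    \<comment> \<open>The factor \<open>exp (- x)\<close> in \<open>k\<close> makes it integrable and shifts the exponent,
      so the moments from \<open>n = 0\<close> on use the transform at \<open>1, 2, ...\<close> only.\<close>
    have "(LINT x|lborel. exp (-x) ^ n * k x) = (LINT x:{0..}|lborel. exp (- (real (Suc n) * x)) * h x)"
      unfolding set_lebesgue_integral_def
      by (intro Bochner_Integration.integral_cong)
         (auto simp: k_def indicator_def exp_of_nat_mult[symmetric] exp_add[symmetric] algebra_simps)
    then show ?thesis using mom[of "Suc n"] by simp
  qed
  have qc: "continuous_on UNIV q" unfolding q_def by (intro continuous_intros)
  note q = integral_against_continuous_eq_0[OF k _ kmom qc]
  have nn: "0 \<le> q (exp (-x)) * k x" and qp: "a < x \<Longrightarrow> x < b \<Longrightarrow> 0 < q (exp (-x)) * k x" for x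
  proof -
    show *: "0 < q (exp (-x)) * k x" if "a < x" "x < b"
      using that ab hpos[OF that] by (auto simp: q_def k_def max_def indicator_def intro!: mult_pos_pos)
    show "0 \<le> q (exp (-x)) * k x"
    proof (cases "a < x \<and> x < b")
      case False
      then have "q (exp (-x)) = 0" by (auto simp: q_def max_def not_less)
      then show ?thesis by simp
    qed (use * in auto)
  qed
  have "AE x in lborel. q (exp (-x)) * k x = 0"
    using integral_nonneg_eq_0_iff_AE[OF q(1)] nn q(2) by (auto simp: k_def)
  then have "AE x in lborel. x \<notin> {a<..<b}"
    by eventually_elim (use qp in force)
  then have "emeasure lborel {a<..<b} = 0" 

    by (rule AE_iff_measurable[THEN iffD1, rotated 2]) auto
  then show False using ab by simp
qed

text \<open>
  Lerch's theorem for continuous functions: the Laplace transform at the positive integers already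
  determines the function. The bound for a difference is applied in both orders, and the value at
  the origin follows by continuity.
\<close>

lemma laplace_transform_inj_continuous:
  fixes f g :: "real \<Rightarrow> real"
  assumes cf: "continuous_on {0..} f" and cg: "continuous_on {0..} g"
    and f: "\<And>n. n \<ge> 1 \<Longrightarrow> set_integrable lborel {0..} (\<lambda>x. exp (- (real n * x)) * f x)"
    and g: "\<And>n. n \<ge> 1 \<Longrightarrow> set_integrable lborel {0..} (\<lambda>x. exp (- (real n * x)) * g x)"
    and eq: "\<And>n. n \<ge> 1 \<Longrightarrow> (LINT x:{0..}|lborel. exp (- (real n * x)) * f x)
                             = (LINT x:{0..}|lborel. exp (- (real n * x)) * g x)"
    and x: "x \<ge> 0"
  shows "f x = g x"
proof -
  have le: "u y - v y \<le> 0" if y: "y > 0"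
    and cu: "continuous_on {0..} u" and cv: "continuous_on {0..} v"
    and u: "\<And>n. n \<ge> 1 \<Longrightarrow> set_integrable lborel {0..} (\<lambda>x. exp (- (real n * x)) * u x)"
    and v: "\<And>n. n \<ge> 1 \<Longrightarrow> set_integrable lborel {0..} (\<lambda>x. exp (- (real n * x)) * v x)"
    and e: "\<And>n. n \<ge> 1 \<Longrightarrow> (LINT x:{0..}|lborel. exp (- (real n * x)) * u x)
                             = (LINT x:{0..}|lborel. exp (- (real n * x)) * v x)"
    for u v :: "real \<Rightarrow> real" and y
  proof (rule continuous_vanishing_laplace_nonpos[OF _ _ _ y, where h = "\<lambda>x. u x - v x"])
    show "continuous_on {0..} (\<lambda>x. u x - v x)" by (intro continuous_intros cu cv)
    show "set_integrable lborel {0..} (\<lambda>x. exp (-x) * (u x - v x))"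
      using set_integral_diff(1)[OF u[of 1] v[of 1]] by (simp add: right_diff_distrib)
    show "(LINT x:{0..}|lborel. exp (- (real n * x)) * (u x - v x)) = 0" if "n \<ge> 1" for n
      using set_integral_diff(2)[OF u[OF that] v[OF that]] e[OF that] by (simp add: right_diff_distrib)
  qed
  have pos: "f y - g y = 0" if "y \<in> {0<..}" for y
    using le[of y f g] le[of y g f] that cf cg f g eq by fastforce
  have "closure {0<..} = {0::real..}" by simp
  then show ?thesis
    using continuous_constant_on_closure[of "{0<..}" "\<lambda>y. f y - g y" 0 x] pos x cf cg
    by (auto intro!: continuous_intros)
qed

section \<open>The gamma density and its distribution function\<close>

text \<open>
  The density at \<open>u\<close> of the gamma distribution with shape \<open>a\<close> and unit rate. The factor
  \<open>1 / Gamma a\<close> is written with the entire function \<open>rGamma\<close>, so that the density is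
  Borel measurable jointly in \<open>a\<close> and \<open>u\<close> on the whole plane.
\<close>

definition gamma_density :: "real \<Rightarrow> real \<Rightarrow> real" where
  "gamma_density a u = indicator {0<..} u * (rGamma a * (u powr (a - 1) * exp (-u)))"

lemma measurable_gamma_density [measurable (raw)]:
  assumes [measurable]: "f \<in> borel_measurable M" "g \<in> borel_measurable M"
  shows "(\<lambda>x. gamma_density (f x) (g x)) \<in> borel_measurable M"
proof -
  have [measurable]: "rGamma \<in> borel_measurable (borel :: real measure)"
    by (intro borel_measurable_continuous_onI continuous_intros)
  show ?thesis unfolding gamma_density_def by measurable
qed

lemma gamma_density_nonneg: "a > 0 \<Longrightarrow> gamma_density a u \<ge> 0"
  by (simp add: gamma_density_def rGamma_inverse_Gamma less_imp_le[OF Gamma_real_pos])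

text \<open>
  Euler's integral for \<open>Gamma a\<close>, after the substitution \<open>t = (1 + s) * u\<close>.
\<close>

lemma nn_integral_gamma_density_laplace:
  assumes a: "a > 0" and s: "s \<ge> 0"
  shows "(\<integral>\<^sup>+u. ennreal (exp (- (s * u)) * gamma_density a u) \<partial>lborel) = ennreal ((1 + s) powr (-a))"
proof -
  define I where "I = (\<integral>\<^sup>+u. ennreal (exp (- (s * u)) * gamma_density a u) \<partial>lborel)"
  have G: "Gamma a > 0" using a by (rule Gamma_real_pos)
  have "ennreal (Gamma a) = \<integral>\<^sup>+ t. ennreal (indicator {0..} t * t powr (a - 1) / exp t) \<partial>lborel"
    by (rule Gamma_conv_nn_integral_real[OF a])
  also have "\<dots> = ennreal \<bar>1 + s\<bar> * (\<integral>\<^sup>+ u. ennreal (indicator {0..} (0 + (1 + s) * u)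
      * (0 + (1 + s) * u) powr (a - 1) / exp (0 + (1 + s) * u)) \<partial>lborel)"
    using s by (intro nn_integral_real_affine) auto
  also have "(\<integral>\<^sup>+ u. ennreal (indicator {0..} (0 + (1 + s) * u)
      * (0 + (1 + s) * u) powr (a - 1) / exp (0 + (1 + s) * u)) \<partial>lborel)
     = (\<integral>\<^sup>+ u. ennreal ((1 + s) powr (a - 1) * Gamma a) * ennreal (exp (- (s * u)) * gamma_density a u) \<partial>lborel)"
  proof (intro nn_integral_cong)
    fix u :: real
    have "indicator {0..} (0 + (1 + s) * u) * (0 + (1 + s) * u) powr (a - 1) / exp (0 + (1 + s) * u)
       = (1 + s) powr (a - 1) * Gamma a * (exp (- (s * u)) * gamma_density a u)"
    proof (cases "u > 0")
      case True
      then have "((1 + s) * u) powr (a - 1) = (1 + s) powr (a - 1) * u powr (a - 1)"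
        using s by (simp add: powr_mult)
      moreover have "0 \<le> (1 + s) * u" using True s by simp
      moreover have "exp ((1 + s) * u) = exp (s * u) * exp u"
        by (simp add: exp_add[symmetric] distrib_right add.commute)
      ultimately show ?thesis
        using True G by (simp add: gamma_density_def rGamma_inverse_Gamma exp_minus field_simps)
    next
      case False
      then have "u = 0 \<or> (1 + s) * u < 0" using s by (auto intro!: mult_pos_neg)
      then show ?thesis using False by (auto simp: gamma_density_def)
    qed
    then show "ennreal (indicator {0..} (0 + (1 + s) * u) * (0 + (1 + s) * u) powr (a - 1) / exp (0 + (1 + s) * u))
       = ennreal ((1 + s) powr (a - 1) * Gamma a) * ennreal (exp (- (s * u)) * gamma_density a u)"
      using s G by (subst ennreal_mult[symmetric]) (auto intro!: mult_nonneg_nonneg gamma_density_nonneg a)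
  qed
  also have "\<dots> = ennreal ((1 + s) powr (a - 1) * Gamma a) * I"
    unfolding I_def by (rule nn_integral_cmult) simp
  finally have "ennreal (Gamma a) = ennreal ((1 + s) * ((1 + s) powr (a - 1) * Gamma a)) * I"
    using s G by (simp add: ennreal_mult mult.assoc)
  also have "(1 + s) * ((1 + s) powr (a - 1) * Gamma a) = (1 + s) powr a * Gamma a"
    using s by (simp add: powr_diff)
  finally have "ennreal ((1 + s) powr (-a) / Gamma a) * ennreal (Gamma a)
      = ennreal ((1 + s) powr (-a) / Gamma a) * (ennreal ((1 + s) powr a * Gamma a) * I)" by simp
  then have "ennreal ((1 + s) powr (-a)) = ennreal 1 * I"
    unfolding mult.assoc[symmetric] using s G
    by (simp add: ennreal_mult[symmetric] powr_minus)
  then show ?thesis by (simp add: I_def)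
qed

lemma integrable_gamma_density:
  assumes "a > 0" shows "integrable lborel (gamma_density a)"
  using nn_integral_gamma_density_laplace[OF assms, of 0] assms
  by (intro integrableI_nonneg) (auto simp: gamma_density_nonneg)

lemma regularized_lower_gamma_conv_density:
  "regularized_lower_gamma a x = (LINT u|lborel. indicator {..x} u * gamma_density a u)"
proof -
  have "regularized_lower_gamma a x =
     (LINT u|lborel. rGamma a * (indicator {0..x} u * (u powr (a - 1) * exp (- u))))"
    by (simp add: regularized_lower_gamma_def set_lebesgue_integral_def rGamma_inverse_Gamma
        inverse_eq_divide)
  also have "\<dots> = (LINT u|lborel. indicator {..x} u * gamma_density a u)"
    by (intro Bochner_Integration.integral_cong) (auto simp: gamma_density_def indicator_def)
  finally show ?thesis .
qed

lemma nn_integral_regularized_lower_gamma: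
  assumes a: "a > 0"
  shows "ennreal (regularized_lower_gamma a x)
       = (\<integral>\<^sup>+u. ennreal (indicator {..x} u * gamma_density a u) \<partial>lborel)"
proof -
  have "integrable lborel (\<lambda>u. indicator {..x} u * gamma_density a u)"
    using integrable_mult_indicator[OF _ integrable_gamma_density[OF a], of "{..x}"] by simp
  then show ?thesis
    unfolding regularized_lower_gamma_conv_density
    by (subst nn_integral_eq_integral) (auto simp: gamma_density_nonneg a)
qed

lemma regularized_lower_gamma_nonneg: "a > 0 \<Longrightarrow> regularized_lower_gamma a x \<ge> 0"
  unfolding regularized_lower_gamma_conv_density
  by (intro Bochner_Integration.integral_nonneg) (auto simp: gamma_density_nonneg)

text \<open>
  A Chernoff bound: \<open>exp (x - u)\<close> dominates the indicator of \<open>u \<le> x\<close>, and the Laplace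
  transform of the density at \<open>1\<close> is \<open>2 powr (- a)\<close>. The exponential decay in \<open>a\<close> is
  what makes the integral over \<open>t\<close> in the scale function converge, locally uniformly in \<open>x\<close>.
\<close>

lemma regularized_lower_gamma_le:
  assumes a: "a > 0"
  shows "regularized_lower_gamma a x \<le> exp x * 2 powr (-a)"
proof -
  have "ennreal (regularized_lower_gamma a x) \<le> (\<integral>\<^sup>+u. ennreal (exp x) * ennreal (exp (- (1 * u)) * gamma_density a u) \<partial>lborel)"
    unfolding nn_integral_regularized_lower_gamma[OF a]
  proof (intro nn_integral_mono)
    fix u :: real
    have "indicator {..x} u \<le> exp x * exp (-u)"
      by (auto simp: indicator_def exp_add[symmetric])
    then have "indicator {..x} u * gamma_density a u \<le> exp x * exp (-u) * gamma_density a u"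
      by (intro mult_right_mono gamma_density_nonneg a)
    then show "ennreal (indicator {..x} u * gamma_density a u)
        \<le> ennreal (exp x) * ennreal (exp (- (1 * u)) * gamma_density a u)"
      by (subst ennreal_mult[symmetric]) (auto intro!: ennreal_leI simp: gamma_density_nonneg a mult.assoc)
  qed
  also have "\<dots> = ennreal (exp x) * ennreal ((1 + 1) powr (-a))"
    by (subst nn_integral_cmult, simp, subst nn_integral_gamma_density_laplace) (auto simp: a)
  also have "\<dots> = ennreal (exp x * 2 powr (-a))" by (simp add: ennreal_mult)
  finally show ?thesis by (simp add: ennreal_le_iff)
qed

lemma measurable_regularized_lower_gamma [measurable (raw)]:
  assumes [measurable]: "f \<in> borel_measurable M" "g \<in> borel_measurable M"
  shows "(\<lambda>x. regularized_lower_gamma (f x) (g x)) \<in> borel_measurable M"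
proof -
  have "regularized_lower_gamma a y
      = (LINT u|lborel. (if u \<le> y then 1 else 0) * gamma_density a u)" for a y
    unfolding regularized_lower_gamma_conv_density
    by (intro Bochner_Integration.integral_cong) (auto simp: indicator_def)
  then show ?thesis by simp
qed

lemma continuous_on_regularized_lower_gamma:
  assumes a: "a > 0"
  shows "continuous_on UNIV (regularized_lower_gamma a)"
proof (rule continuous_on_sequentiallyI)
  fix X :: "nat \<Rightarrow> real" and x assume X: "X \<longlonglongrightarrow> x"
  show "(\<lambda>n. regularized_lower_gamma a (X n)) \<longlonglongrightarrow> regularized_lower_gamma a x"
    unfolding regularized_lower_gamma_conv_density
  proof (rule integral_dominated_convergence[where w = "gamma_density a"])
    show "AE u in lborel. (\<lambda>n. indicator {..X n} u * gamma_density a u) \<longlonglongrightarrow> indicator {..x} u * gamma_density a u"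
      using AE_lborel_singleton[of x]
    proof eventually_elim
      case (elim u)
      have "\<forall>\<^sub>F n in sequentially. (u \<le> X n) = (u \<le> x)"
      proof (cases "u < x")
        case True
        then show ?thesis using order_tendstoD(1)[OF X True] by (auto elim: eventually_mono)
      next
        case False
        with elim have "x < u" by simp
        then show ?thesis using order_tendstoD(2)[OF X \<open>x < u\<close>] by (auto elim!: eventually_mono)
      qed
      then show ?case
        by (intro tendsto_eventually) (auto simp: indicator_def elim!: eventually_mono)
    qed
    show "AE u in lborel. norm (indicator {..X n} u * gamma_density a u) \<le> gamma_density a u" for n
      by (auto simp: indicator_def gamma_density_nonneg a)
  qed (auto simp: integrable_gamma_density a)
qed

section \<open>Exponential integrals\<close>

lemma nn_integral_exp_atLeast:
  fixes k u :: real
  assumes k: "k > 0"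
  shows "(\<integral>\<^sup>+t. ennreal (exp (- (k * t))) * indicator {u..} t \<partial>lborel) = ennreal (exp (- (k * u)) / k)"
proof -
  have lim: "((\<lambda>t. - exp (- (k * t)) / k) \<longlongrightarrow> 0) at_top"
    using k by real_asymp
  have "(\<integral>\<^sup>+t. ennreal (exp (- (k * t))) * indicator {u..} t \<partial>lborel) = ennreal (0 - (- exp (- (k * u)) / k))"
    using k by (intro nn_integral_FTC_atLeast[OF _ _ _ lim]) (auto intro!: derivative_eq_intros)
  then show ?thesis by simp
qed

lemma nn_integral_exp_greaterThan_0:
  fixes k :: real
  assumes k: "k > 0"
  shows "(\<integral>\<^sup>+t. indicator {0<..} t * ennreal (exp (- (k * t))) \<partial>lborel) = ennreal (1 / k)"
proof -
  have "(\<integral>\<^sup>+t. indicator {0<..} t * ennreal (exp (- (k * t))) \<partial>lborel)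
      = (\<integral>\<^sup>+t. ennreal (exp (- (k * t))) * indicator {0..} t \<partial>lborel)"
    using AE_lborel_singleton[of "0::real"]
    by (intro nn_integral_cong_AE) (auto simp: indicator_def elim!: eventually_mono)
  then show ?thesis using nn_integral_exp_atLeast[OF k, of 0] by simp
qed

lemma set_integrable_exp_bound:
  fixes c B :: real
  assumes c: "c > 0"
  shows "set_integrable lborel {0<..} (\<lambda>t. B * 2 powr (- (c * t)))"
proof -
  have "integrable lborel (\<lambda>t. indicator {0<..} t * exp (- (c * ln 2 * t)))"
    using nn_integral_exp_greaterThan_0[of "c * ln 2"] c
    by (intro integrableI_nonneg) (auto simp: ennreal_mult ennreal_indicator)
  then have "integrable lborel (\<lambda>t. B * (indicator {0<..} t * exp (- (c * ln 2 * t))))" by simp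
  then show ?thesis by (simp add: set_integrable_def powr_def mult_ac)
qed

section \<open>The renewal function of the gamma subordinator\<close>

text \<open>
  The renewal function of the gamma subordinator with unit rate, whose value at time \<open>t\<close> has
  shape \<open>c * t\<close>: the expected time that it spends in \<open>[0, y]\<close>.
\<close>

definition gamma_potential :: "real \<Rightarrow> real \<Rightarrow> real" where
  "gamma_potential c y = (LINT t:{0<..}|lborel. regularized_lower_gamma (c * t) y)"

lemma set_integrable_regularized_lower_gamma:
  assumes c: "c > 0"
  shows "set_integrable lborel {0<..} (\<lambda>t. regularized_lower_gamma (c * t) y)"
  unfolding set_integrable_def
proof (rule Bochner_Integration.integrable_bound[OF set_integrable_exp_bound[OF c, of "exp y", unfolded set_integrable_def]])
  show "AE t in lborel. norm (indicator {0<..} t *\<^sub>R regularized_lower_gamma (c * t) y)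
      \<le> norm (indicator {0<..} t *\<^sub>R (exp y * 2 powr (- (c * t))))"
    using c regularized_lower_gamma_le[of "c * _" y] regularized_lower_gamma_nonneg[of "c * _" y]
    by (auto simp: indicator_def)
qed measurable

lemma gamma_potential_nonneg: "c > 0 \<Longrightarrow> gamma_potential c y \<ge> 0"
  unfolding gamma_potential_def set_lebesgue_integral_def
  by (intro Bochner_Integration.integral_nonneg) (auto simp: indicator_def regularized_lower_gamma_nonneg)

lemma measurable_gamma_potential [measurable]: "gamma_potential c \<in> borel_measurable borel"
  unfolding gamma_potential_def[abs_def] set_lebesgue_integral_def by measurable

lemma continuous_on_gamma_potential:
  assumes c: "c > 0"
  shows "continuous_on UNIV (gamma_potential c)"
proof (rule continuous_on_sequentiallyI)
  fix X :: "nat \<Rightarrow> real" and x assume X: "X \<longlonglongrightarrow> x"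
  obtain B where B: "\<And>n. X n \<le> B"
    using convergent_imp_Bseq[of X] X by (auto simp: convergent_def Bseq_def dest: abs_le_D1)
  show "(\<lambda>n. gamma_potential c (X n)) \<longlonglongrightarrow> gamma_potential c x"
    unfolding gamma_potential_def set_lebesgue_integral_def
  proof (rule integral_dominated_convergence)
    show "integrable lborel (\<lambda>t. indicator {0<..} t *\<^sub>R (exp B * 2 powr (- (c * t))))"
      using set_integrable_exp_bound[OF c] by (simp add: set_integrable_def)
    have "(\<lambda>n. indicator {0<..} t *\<^sub>R regularized_lower_gamma (c * t) (X n))
        \<longlonglongrightarrow> indicator {0<..} t *\<^sub>R regularized_lower_gamma (c * t) x" for t
    proof (cases "t > 0")
      case True
      then show ?thesis
        using continuous_on_tendsto_compose[OF continuous_on_regularized_lower_gamma X, of "c * t"] c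
        by (auto intro!: tendsto_intros)
    qed simp
    then show "AE t in lborel. (\<lambda>n. indicator {0<..} t *\<^sub>R regularized_lower_gamma (c * t) (X n))
        \<longlonglongrightarrow> indicator {0<..} t *\<^sub>R regularized_lower_gamma (c * t) x" by simp
    have "regularized_lower_gamma (c * t) (X n) \<le> exp B * 2 powr (- (c * t))" if "t > 0" for t n
    proof -
      have "regularized_lower_gamma (c * t) (X n) \<le> exp (X n) * 2 powr (- (c * t))"
        using c that by (intro regularized_lower_gamma_le) auto
      also have "\<dots> \<le> exp B * 2 powr (- (c * t))" using B[of n] by simp
      finally show ?thesis .
    qed
    then show "AE t in lborel. norm (indicator {0<..} t *\<^sub>R regularized_lower_gamma (c * t) (X n))
        \<le> indicator {0<..} t *\<^sub>R (exp B * 2 powr (- (c * t)))" for n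
      using c by (auto simp: indicator_def regularized_lower_gamma_nonneg)
  qed measurable
qed

lemma nn_integral_gamma_potential:
  assumes c: "c > 0"
  shows "ennreal (gamma_potential c y) =
    (\<integral>\<^sup>+t. indicator {0<..} t * (\<integral>\<^sup>+u. ennreal (indicator {..y} u * gamma_density (c * t) u) \<partial>lborel) \<partial>lborel)"
proof -
  have "ennreal (gamma_potential c y) = (\<integral>\<^sup>+t. ennreal (indicator {0<..} t *\<^sub>R regularized_lower_gamma (c * t) y) \<partial>lborel)"
    unfolding gamma_potential_def set_lebesgue_integral_def
    using set_integrable_regularized_lower_gamma[OF c, of y] c
    by (subst nn_integral_eq_integral) (auto simp: set_integrable_def indicator_def regularized_lower_gamma_nonneg)
  also have "\<dots> = (\<integral>\<^sup>+t. indicator {0<..} t * (\<integral>\<^sup>+u. ennreal (indicator {..y} u * gamma_density (c * t) u) \<partial>lborel) \<partial>lborel)"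
    using c by (intro nn_integral_cong) (auto simp: indicator_def nn_integral_regularized_lower_gamma)
  finally show ?thesis .
qed

text \<open>
  With the distribution function written as the integral of the density, this is a triple integral
  of a nonnegative function over \<open>x\<close>, \<open>t\<close> and \<open>u\<close>. By Tonelli it may be done in the
  order \<open>x\<close>, \<open>u\<close>, \<open>t\<close>. Up to the factor \<open>1 / \<theta>\<close> the first leaves
  \<open>exp (- s * u)\<close> with \<open>s = \<theta> / \<gamma>\<close>, the second \<open>(1 + s) powr (- c * t)\<close>, and the third
  \<open>1 / (c * ln (1 + s))\<close>.
\<close>

lemma nn_integral_laplace_gamma_potential:
  assumes c: "c > 0" and g: "\<gamma> > 0" and \<theta>: "\<theta> > 0"
  shows "(\<integral>\<^sup>+x. ennreal (indicator {0..} x * (exp (- (\<theta> * x)) * gamma_potential c (\<gamma> * x))) \<partial>lborel)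
       = ennreal (1 / (c * \<theta> * ln (1 + \<theta> / \<gamma>)))"
proof -
  define s where "s = \<theta> / \<gamma>"
  have s: "s > 0" using g \<theta> by (simp add: s_def)
  have ls: "ln (1 + s) > 0" using s by simp
  define K where "K = (\<lambda>x t u :: real. indicator {0<..} t *
      (ennreal (exp (- (\<theta> * x))) * indicator {u / \<gamma>..} x * ennreal (gamma_density (c * t) u)))"
  have [measurable]: "(\<lambda>(x, t, u). K x t u) \<in> borel_measurable (lborel \<Otimes>\<^sub>M lborel \<Otimes>\<^sub>M lborel)"
  proof -
    \<comment> \<open>The indicator of \<open>{u / \<gamma>..}\<close> depends on \<open>u\<close> through its set; as a comparison
      it is visibly measurable in \<open>(x, u)\<close>.\<close>
    have "K = (\<lambda>x t u. (if 0 < t then 1 else 0) *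
      (ennreal (exp (- (\<theta> * x))) * (if u / \<gamma> \<le> x then 1 else 0) * ennreal (gamma_density (c * t) u)))"
      by (auto simp: K_def fun_eq_iff indicator_def)
    then show ?thesis by simp
  qed
  have mK [measurable]: "(\<lambda>w. K (f w) (g w) (h w)) \<in> borel_measurable N"
    if [measurable]: "f \<in> borel_measurable N" "g \<in> borel_measurable N" "h \<in> borel_measurable N" for f g h and N :: "'z measure"
  proof -
    have "(\<lambda>w. (\<lambda>(x, t, u). K x t u) (f w, g w, h w)) \<in> borel_measurable N" by measurable
    then show ?thesis by simp
  qed
  have "(\<integral>\<^sup>+x. ennreal (indicator {0..} x * (exp (- (\<theta> * x)) * gamma_potential c (\<gamma> * x))) \<partial>lborel)
      = (\<integral>\<^sup>+x. \<integral>\<^sup>+t. \<integral>\<^sup>+u. K x t u \<partial>lborel \<partial>lborel \<partial>lborel)"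
  proof (intro nn_integral_cong)
    fix x :: real
    \<comment> \<open>The density vanishes for \<open>u \<le> 0\<close>; for \<open>u > 0\<close> the constraint \<open>u \<le> \<gamma> * x\<close>
      forces \<open>x > 0\<close>, so the indicator of \<open>{0..}\<close> can be dropped.\<close>
    have dens: "indicator {0..} x * ennreal (exp (- (\<theta> * x))) * (indicator {0<..} t * ennreal (indicator {..\<gamma> * x} u * gamma_density (c * t) u))
       = K x t u" for t u
    proof (cases "u > 0")
      case True
      have "u / \<gamma> \<le> x \<longleftrightarrow> u \<le> \<gamma> * x" using g by (simp add: field_simps)
      moreover have "0 \<le> x" if "u \<le> \<gamma> * x"
      proof -
        have "0 < \<gamma> * x" using that True by linarith
        then show ?thesis using g by (simp add: zero_less_mult_iff)
      qed
      ultimately show ?thesis by (auto simp: K_def indicator_def)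
    qed (auto simp: K_def gamma_density_def)
    have "ennreal (indicator {0..} x * (exp (- (\<theta> * x)) * gamma_potential c (\<gamma> * x)))
       = (indicator {0..} x * ennreal (exp (- (\<theta> * x)))) * ennreal (gamma_potential c (\<gamma> * x))"
      using gamma_potential_nonneg[OF c, of "\<gamma> * x"] by (auto simp: indicator_def ennreal_mult)
    also have "\<dots> = (\<integral>\<^sup>+t. \<integral>\<^sup>+u. (indicator {0..} x * ennreal (exp (- (\<theta> * x)))) *
        (indicator {0<..} t * ennreal (indicator {..\<gamma> * x} u * gamma_density (c * t) u)) \<partial>lborel \<partial>lborel)"
      unfolding nn_integral_gamma_potential[OF c]
      by (subst nn_integral_cmult[symmetric], measurable) (simp add: nn_integral_cmult)
    finally show "ennreal (indicator {0..} x * (exp (- (\<theta> * x)) * gamma_potential c (\<gamma> * x)))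
       = (\<integral>\<^sup>+t. \<integral>\<^sup>+u. K x t u \<partial>lborel \<partial>lborel)" by (simp only: dens)
  qed
  also have "\<dots> = (\<integral>\<^sup>+t. \<integral>\<^sup>+x. \<integral>\<^sup>+u. K x t u \<partial>lborel \<partial>lborel \<partial>lborel)"
    by (rule lborel_pair.Fubini') measurable
  also have "\<dots> = (\<integral>\<^sup>+t. \<integral>\<^sup>+u. \<integral>\<^sup>+x. K x t u \<partial>lborel \<partial>lborel \<partial>lborel)"
    by (intro nn_integral_cong lborel_pair.Fubini') measurable
  also have "\<dots> = (\<integral>\<^sup>+t. ennreal (1 / \<theta>) * (indicator {0<..} t * ennreal (exp (- (c * ln (1 + s) * t)))) \<partial>lborel)"
  proof (intro nn_integral_cong)
    fix t :: real
    have "(\<integral>\<^sup>+x. K x t u \<partial>lborel)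
       = indicator {0<..} t * (ennreal (1 / \<theta>) * ennreal (exp (- (s * u)) * gamma_density (c * t) u))" for u
    proof (cases "t > 0")
      case True
      have "(\<integral>\<^sup>+x. K x t u \<partial>lborel) = ennreal (exp (- (\<theta> * (u / \<gamma>))) / \<theta>) * ennreal (gamma_density (c * t) u)"
        unfolding K_def using True nn_integral_exp_atLeast[OF \<theta>, of "u / \<gamma>"]
        by (simp add: nn_integral_multc)
      then show ?thesis using True c \<theta>
        by (simp add: ennreal_mult[symmetric] gamma_density_nonneg s_def)
    qed (simp add: K_def)
    then have "(\<integral>\<^sup>+u. \<integral>\<^sup>+x. K x t u \<partial>lborel \<partial>lborel)
      = indicator {0<..} t * (ennreal (1 / \<theta>) * (\<integral>\<^sup>+u. ennreal (exp (- (s * u)) * gamma_density (c * t) u) \<partial>lborel))"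
      by (simp add: nn_integral_cmult)
    also have "\<dots> = ennreal (1 / \<theta>) * (indicator {0<..} t * ennreal (exp (- (c * ln (1 + s) * t))))"
    proof (cases "t > 0")
      case True
      have "(1 + s) powr (- (c * t)) = exp (- (c * ln (1 + s) * t))"
        using s by (simp add: powr_def mult_ac)
      then show ?thesis
        using True c s nn_integral_gamma_density_laplace[of "c * t" s] by simp
    qed simp
    finally show "(\<integral>\<^sup>+u. \<integral>\<^sup>+x. K x t u \<partial>lborel \<partial>lborel)
      = ennreal (1 / \<theta>) * (indicator {0<..} t * ennreal (exp (- (c * ln (1 + s) * t))))" .
  qed
  also have "\<dots> = ennreal (1 / \<theta>) * ennreal (1 / (c * ln (1 + s)))"
    using nn_integral_exp_greaterThan_0[of "c * ln (1 + s)"] c ls by (simp add: nn_integral_cmult)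
  also have "\<dots> = ennreal (1 / (c * \<theta> * ln (1 + \<theta> / \<gamma>)))"
    using c ls \<theta> by (simp add: ennreal_mult[symmetric] s_def mult_ac)
  finally show ?thesis .
qed

lemma laplace_gamma_potential:
  assumes c: "c > 0" and g: "\<gamma> > 0" and \<theta>: "\<theta> > 0"
  shows "set_integrable lborel {0..} (\<lambda>x. exp (- (\<theta> * x)) * gamma_potential c (\<gamma> * x))"
    and "(LINT x:{0..}|lborel. exp (- (\<theta> * x)) * gamma_potential c (\<gamma> * x))
       = 1 / (c * \<theta> * ln (1 + \<theta> / \<gamma>))"
proof -
  have "has_bochner_integral lborel
     (\<lambda>x. indicator {0..} x * (exp (- (\<theta> * x)) * gamma_potential c (\<gamma> * x)))
     (1 / (c * \<theta> * ln (1 + \<theta> / \<gamma>)))"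
    using nn_integral_laplace_gamma_potential[OF assms] c g \<theta>
    by (intro has_bochner_integral_nn_integral) (auto simp: gamma_potential_nonneg)
  then show "set_integrable lborel {0..} (\<lambda>x. exp (- (\<theta> * x)) * gamma_potential c (\<gamma> * x))"
    and "(LINT x:{0..}|lborel. exp (- (\<theta> * x)) * gamma_potential c (\<gamma> * x))
       = 1 / (c * \<theta> * ln (1 + \<theta> / \<gamma>))"
    by (auto simp: has_bochner_integral_iff set_integrable_def set_lebesgue_integral_def)
qed

section \<open>The scale function\<close>

lemma Phi_zero_log_exponent:
  assumes "c > 0" "\<gamma> > 0"
    and \<psi>: "\<And>r::real. r \<ge> 0 \<Longrightarrow> \<psi> (complex_of_real r) = complex_of_real (c * r * ln (1 + r / \<gamma>))"
  shows "Phi_zero \<psi> = 0"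
proof -
  have "\<psi> (complex_of_real r) = 0 \<longleftrightarrow> r = 0" if "r \<ge> 0" for r
    using assms that by (simp del: of_real_mult add: ln_eq_zero_iff add_pos_nonneg)
  then have "{r::real. 0 \<le> r \<and> \<psi> (complex_of_real r) = 0} = {0}" by auto
  then show ?thesis by (simp add: Phi_zero_def)
qed

text \<open>
  The defining property of the scale function on the real axis, where the complex integrand and
  transform are real.
\<close>

lemma scale_function_real_laplace:
  assumes W: "scale_function \<psi> W" and r: "Phi_zero \<psi> < r"
    and \<psi>: "\<psi> (complex_of_real r) = complex_of_real v"
  shows "set_integrable lborel {0..} (\<lambda>x. exp (- (r * x)) * W x)"
    and "(LINT x:{0..}|lborel. exp (- (r * x)) * W x) = 1 / v"
proof -
  have e: "exp (- complex_of_real r * complex_of_real x) * complex_of_real (W x)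
      = complex_of_real (exp (- (r * x)) * W x)" for x
    by (simp add: exp_of_real[symmetric])
  have *: "set_integrable lborel {0..} (\<lambda>x. complex_of_real (exp (- (r * x)) * W x))"
    "(LINT x:{0..}|lborel. complex_of_real (exp (- (r * x)) * W x)) = 1 / complex_of_real v"
    using W r unfolding scale_function_def e[symmetric] \<psi>[symmetric] by auto
  have "integrable lborel (\<lambda>x. complex_of_real (indicator {0..} x * (exp (- (r * x)) * W x)))"
    using *(1) by (simp add: set_integrable_def scaleR_conv_of_real)
  then show "set_integrable lborel {0..} (\<lambda>x. exp (- (r * x)) * W x)"
    unfolding complex_of_real_integrable_eq by (simp add: set_integrable_def)
  have "complex_of_real (LINT x:{0..}|lborel. exp (- (r * x)) * W x) = complex_of_real (1 / v)"
    using *(2) unfolding set_integral_complex_of_real by simp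
  then show "(LINT x:{0..}|lborel. exp (- (r * x)) * W x) = 1 / v"
    unfolding of_real_eq_iff .
qed

theorem theorem6p3:
  fixes M :: "'a measure" and X :: "real \<Rightarrow> 'a \<Rightarrow> real"
    and \<psi> :: "complex \<Rightarrow> complex" and W :: "real \<Rightarrow> real" and c \<gamma> x :: real
  assumes "c > 0" and "\<gamma> > 0"
    and "spectrally_negative_levy_process M X"
    and "laplace_exponent M X \<psi>"
    and "\<And>\<theta>. 0 \<le> Re \<theta> \<Longrightarrow>
           \<psi> \<theta> = - complex_of_real c * \<theta>
                  * Ln (complex_of_real \<gamma> / (complex_of_real \<gamma> + \<theta>))"
    and "scale_function \<psi> W"
    and "x \<ge> 0"
  shows "set_integrable lborel {0<..} (\<lambda>t. regularized_lower_gamma (c * t) (\<gamma> * x)) \<and>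
         W x = (LINT t:{0<..}|lborel. regularized_lower_gamma (c * t) (\<gamma> * x))"
proof -
  note c = assms(1) and g = assms(2) and W = assms(6)
  have \<psi>: "\<psi> (complex_of_real r) = complex_of_real (c * r * ln (1 + r / \<gamma>))" if r: "r \<ge> 0" for r
  proof -
    have "complex_of_real \<gamma> / (complex_of_real \<gamma> + complex_of_real r) = complex_of_real (\<gamma> / (\<gamma> + r))"
      by simp
    then have "Ln (complex_of_real \<gamma> / (complex_of_real \<gamma> + complex_of_real r))
        = complex_of_real (ln (\<gamma> / (\<gamma> + r)))"
      using g r by (simp only:) (rule Ln_of_real, simp)
    moreover have "ln (\<gamma> / (\<gamma> + r)) = - ln (1 + r / \<gamma>)"
    proof -
      have "1 + r / \<gamma> = inverse (\<gamma> / (\<gamma> + r))" using g r by (simp add: field_simps)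
      then show ?thesis using g r by (simp add: ln_inverse del: inverse_divide)
    qed
    ultimately show ?thesis using assms(5)[of "complex_of_real r"] r by simp
  qed
  have \<Phi>: "Phi_zero \<psi> = 0" by (rule Phi_zero_log_exponent[OF c g \<psi>])
  have W_laplace: "set_integrable lborel {0..} (\<lambda>x. exp (- (real n * x)) * W x)"
    "(LINT x:{0..}|lborel. exp (- (real n * x)) * W x) = 1 / (c * real n * ln (1 + real n / \<gamma>))"
    if "n \<ge> 1" for n
    using scale_function_real_laplace[OF W _ \<psi>, of "real n"] that \<Phi> by auto
  have "continuous_on {0..} (\<lambda>x. gamma_potential c (\<gamma> * x))"
    by (intro continuous_on_compose2[OF continuous_on_gamma_potential[OF c]] continuous_intros) auto
  moreover have "continuous_on {0..} W" using W by (simp add: scale_function_def)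
  ultimately have "W x = gamma_potential c (\<gamma> * x)"
  proof (intro laplace_transform_inj_continuous[where f = W and g = "\<lambda>x. gamma_potential c (\<gamma> * x)"])
    fix n :: nat assume n: "n \<ge> 1"
    then have pos: "real n > 0" by simp
    show "set_integrable lborel {0..} (\<lambda>x. exp (- (real n * x)) * W x)"
      by (rule W_laplace(1)[OF n])
    show "set_integrable lborel {0..} (\<lambda>x. exp (- (real n * x)) * gamma_potential c (\<gamma> * x))"
      by (rule laplace_gamma_potential(1)[OF c g pos])
    show "(LINT x:{0..}|lborel. exp (- (real n * x)) * W x)
        = (LINT x:{0..}|lborel. exp (- (real n * x)) * gamma_potential c (\<gamma> * x))"
      by (simp only: W_laplace(2)[OF n] laplace_gamma_potential(2)[OF c g pos])
  qed (use assms(7) in auto)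
  then show ?thesis
    using set_integrable_regularized_lower_gamma[OF c] by (simp add: gamma_potential_def)
qed

end
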